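(* Let $X$ be a non-negative and absolutely continuous random variable, and let $Y=aX+b$ with $a>0$ and $b>0$. Then for all $t_1,t_2$ with $F_Y(t_1)<F_Y(t_2)$, where $F_Y$ is the distribution function of $Y$, the interval varextropies of $X$ and $Y$ are related by $$IV_{Y}(t_1,t_2)=\frac{1}{a^2}\,IV_{X}\Big(\frac{t_1-b}{a},\frac{t_2-b}{a}\Big).$$
   Context: For an absolutely continuous non-negative random variable $Z$ with density $f_Z$ (equal to $0$ on the negative half-line) and distribution function $F_Z$, and $u,v$ with $F_Z(u)<F_Z(v)$, the interval varextropy of $Z$ is $$IV_Z(u,v)=\frac{1}{4(F_Z(v)-F_Z(u))^3}\int_u^v f_Z(x)^3\,dx-\frac{1}{4(F_Z(v)-F_Z(u))^4}\Big(\int_u^v f_Z(x)^2\,dx\Big)^2 ,$$ i.e. the variance of $-\tfrac12 f_{u,v}(Z_{u,v})$, where $Z_{u,v}=(Z\mid u<Z<v)$ and $f_{u,v}=f_Z/(F_Z(v)-F_Z(u))$ is its density on $(u,v)$. The integrals are assumed finite. *)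

theory Defs
  imports "HOL-Probability.Probability"
begin

definition abs_continuous_rv :: "'a measure \<Rightarrow> ('a \<Rightarrow> real) \<Rightarrow> bool" where
  "abs_continuous_rv M Z \<longleftrightarrow>
     Z \<in> borel_measurable M \<and> absolutely_continuous lborel (distr M borel Z)"

(* The density of a non-negative, absolutely continuous random variable, with the convention
   that it is 0 on the negative half-line. The Radon-Nikodym derivative fixes one version;
   the integrals below do not depend on the choice. *)
definition rv_density :: "'a measure \<Rightarrow> ('a \<Rightarrow> real) \<Rightarrow> real \<Rightarrow> real" where
  "rv_density M Z x = (if x < 0 then 0 else enn2real (RN_deriv lborel (distr M borel Z) x))"

abbreviation rv_cdf :: "'a measure \<Rightarrow> ('a \<Rightarrow> real) \<Rightarrow> real \<Rightarrow> real" where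
  "rv_cdf M Z \<equiv> cdf (distr M borel Z)"

definition interval_varextropy :: "'a measure \<Rightarrow> ('a \<Rightarrow> real) \<Rightarrow> real \<Rightarrow> real \<Rightarrow> real" where
  "interval_varextropy M Z u v =
     1 / (4 * (rv_cdf M Z v - rv_cdf M Z u) ^ 3) * (LBINT x:{u<..<v}. rv_density M Z x ^ 3)
   - 1 / (4 * (rv_cdf M Z v - rv_cdf M Z u) ^ 4) * (LBINT x:{u<..<v}. rv_density M Z x ^ 2) ^ 2"

(* Finiteness of the two integrals: the Bochner integral of a non-integrable function is 0 by
   convention, so this has to be required separately. *)
definition finite_varextropy_integrals ::
    "'a measure \<Rightarrow> ('a \<Rightarrow> real) \<Rightarrow> real \<Rightarrow> real \<Rightarrow> bool" where
  "finite_varextropy_integrals M Z u v \<longleftrightarrow>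
     set_integrable lborel {u<..<v} (\<lambda>x. rv_density M Z x ^ 3) \<and>
     set_integrable lborel {u<..<v} (\<lambda>x. rv_density M Z x ^ 2)"

lemma distributed_rv_density:
  assumes "prob_space M" and Z: "abs_continuous_rv M Z" and nonneg: "AE \<omega> in M. 0 \<le> Z \<omega>"
  shows "distributed M lborel Z (\<lambda>x. ennreal (rv_density M Z x))"
proof -
  interpret prob_space M by fact
  let ?D = "distr M borel Z"
  let ?r = "RN_deriv lborel ?D"
  have meas: "Z \<in> borel_measurable M" and ac: "absolutely_continuous lborel ?D"
    using Z by (auto simp: abs_continuous_rv_def)
  interpret D: prob_space ?D using meas by (rule prob_space_distr)
  have dens: "density lborel ?r = distr M borel Z"
    by (rule sigma_finite_measure.density_RN_deriv[OF sigma_finite_lborel ac]) simp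
  have fin: "AE x in lborel. ?r x \<noteq> \<infinity>"
    by (rule sigma_finite_measure.RN_deriv_finite[OF sigma_finite_lborel _ ac]) (auto intro: D.sigma_finite_measure_axioms)
  have "AE x in ?D. 0 \<le> x"
    using nonneg meas by (subst AE_distr_iff) auto
  hence "AE x in density lborel ?r. 0 \<le> x" unfolding dens .
  hence "AE x in lborel. 0 < ?r x \<longrightarrow> 0 \<le> x"
    by (subst (asm) AE_density) auto
  with fin have eq: "AE x in lborel. ?r x = ennreal (rv_density M Z x)"
  proof eventually_elim
    case (elim x)
    then show ?case
      by (cases "x < 0") (auto simp: rv_density_def less_top[symmetric] not_less)
  qed
  have "density lborel (\<lambda>x. ennreal (rv_density M Z x)) = density lborel ?r"
    using eq by (intro density_cong) (auto simp: rv_density_def)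
  with dens have "density lborel (\<lambda>x. ennreal (rv_density M Z x)) = ?D" by simp
  moreover have "distr M lborel Z = ?D" by (rule distr_cong) auto
  ultimately show ?thesis using meas
    by (auto simp: distributed_def rv_density_def)
qed

end

theory Submission
  imports Defs
begin

text \<open>Since \<open>a > 0\<close>, F_Y(t) = F_X((t-b)/a), so both intervals carry the same
  probability and the normalising factors agree (\<open>cdf_affine\<close>). The density of Y is
  f_X((x-b)/a)/a almost everywhere (\<open>AE_rv_density_affine\<close>). Substituting x = b + a*y,
  the integral of f_Y^(n+1) is a^(-n) times that of f_X^(n+1)
  (\<open>set_lebesgue_integral_rv_density_affine\<close>). The cubic integral thus gains 1/a^2 and
  the quadratic one 1/a; the latter is squared, so 1/a^2 factors out of both terms.\<close>

lemma abs_continuous_rv_if_distributed: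
  assumes "distributed M lborel Z g"
  shows "abs_continuous_rv M Z"
proof -
  have "distr M borel Z = distr M lborel Z"
    by (rule distr_cong) auto
  also have "\<dots> = density lborel g"
    using assms by (rule distributed_distr_eq_density)
  finally show ?thesis
    using assms
    by (auto simp: abs_continuous_rv_def distributed_def intro!: absolutely_continuousI_density)
qed

lemma cdf_affine:
  fixes Z :: "'a \<Rightarrow> real"
  assumes "Z \<in> borel_measurable M" and "a > 0"
  shows "rv_cdf M (\<lambda>\<omega>. a * Z \<omega> + b) t = rv_cdf M Z ((t - b) / a)"
proof -
  have "(\<lambda>\<omega>. a * Z \<omega> + b) -` {..t} \<inter> space M = Z -` {..(t - b) / a} \<inter> space M"
    using \<open>a > 0\<close> by (auto simp: field_simps)
  then show ?thesis
    using assms by (simp add: cdf_def measure_distr)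
qed

text \<open>Both sides are densities of the same law, hence equal almost everywhere; a Radon-Nikodym
  derivative gives no pointwise equality. The condition \<open>b \<ge> 0\<close> keeps the affine
  image non-negative, so cutting its density off below 0 loses no mass.\<close>

lemma AE_rv_density_affine:
  fixes Z :: "'a \<Rightarrow> real"
  assumes "prob_space M" and Z: "abs_continuous_rv M Z" and nonneg: "AE \<omega> in M. 0 \<le> Z \<omega>"
    and "a > 0" and "b \<ge> 0"
  shows "AE x in lborel. rv_density M (\<lambda>\<omega>. a * Z \<omega> + b) x = rv_density M Z ((x - b) / a) / a"
proof -
  interpret prob_space M by fact
  let ?Y = "\<lambda>\<omega>. a * Z \<omega> + b"
  let ?g = "\<lambda>x. ennreal (rv_density M Z ((x - b) / a) / a)"
  have "distributed M lborel Z (\<lambda>x. ennreal (rv_density M Z x))"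
    using assms by (intro distributed_rv_density)
  from distributed_affine[OF this, where t = b and c = a]
  have Y: "distributed M lborel ?Y ?g"
    using \<open>a > 0\<close> by (simp add: divide_ennreal rv_density_def add.commute)
  have "AE \<omega> in M. 0 \<le> ?Y \<omega>"
    using nonneg by eventually_elim (use \<open>a > 0\<close> \<open>b \<ge> 0\<close> in auto)
  \<comment> \<open>Absolute continuity of \<open>?Y\<close> is read off from the explicit density
    \<open>?g\<close>.\<close>
  then have "distributed M lborel ?Y (\<lambda>x. ennreal (rv_density M ?Y x))"
    using Y assms(1) by (intro distributed_rv_density abs_continuous_rv_if_distributed)
  from distributed_unique[OF this Y]
  have "AE x in lborel. ennreal (rv_density M ?Y x) = ?g x" .
  then show ?thesis
    by eventually_elim (use \<open>a > 0\<close> in \<open>auto simp: rv_density_def split: if_splits\<close>)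
qed

lemma borel_measurable_rv_density [measurable]: "rv_density M Z \<in> borel_measurable borel"
  unfolding rv_density_def by measurable

text \<open>The power of the density contributes n+1 factors 1/a, and the Jacobian of x = b + a*y
  cancels one of them.\<close>

lemma set_lebesgue_integral_rv_density_affine:
  fixes Z :: "'a \<Rightarrow> real"
  assumes "prob_space M" and "abs_continuous_rv M Z" and "AE \<omega> in M. 0 \<le> Z \<omega>"
    and "a > 0" and "b \<ge> 0"
  shows "(LBINT x:{u<..<v}. rv_density M (\<lambda>\<omega>. a * Z \<omega> + b) x ^ Suc n)
       = 1 / a ^ n * (LBINT x:{(u - b) / a<..<(v - b) / a}. rv_density M Z x ^ Suc n)"
proof -
  \<comment> \<open>With the indicator inside the integrand, the substitution on the whole line also
    transforms the endpoints.\<close>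
  let ?h = "\<lambda>x. indicator {u<..<v} x * (rv_density M Z ((x - b) / a) / a) ^ Suc n"
  have "(LBINT x:{u<..<v}. rv_density M (\<lambda>\<omega>. a * Z \<omega> + b) x ^ Suc n) = (LBINT x. ?h x)"
    unfolding set_lebesgue_integral_def real_scaleR_def
    by (intro integral_cong_AE) (use AE_rv_density_affine[OF assms] in auto)
  also have "\<dots> = a * (LBINT x. ?h (b + a * x))"
    using \<open>a > 0\<close> by (subst lborel_integral_real_affine[of a _ b]) auto
  also have "(LBINT x. ?h (b + a * x)) =
      (LBINT x. (1 / a ^ Suc n) * (indicator {(u - b) / a<..<(v - b) / a} x * rv_density M Z x ^ Suc n))"
    using \<open>a > 0\<close> by (intro Bochner_Integration.integral_cong)
      (auto simp: indicator_def field_simps)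
  also have "a * \<dots> = 1 / a ^ n * (LBINT x:{(u - b) / a<..<(v - b) / a}. rv_density M Z x ^ Suc n)"
    using \<open>a > 0\<close> unfolding set_lebesgue_integral_def real_scaleR_def
    by (subst integral_mult_right_zero) simp
  finally show ?thesis .
qed

theorem theorem1:
  fixes M :: "'a measure" and X Y :: "'a \<Rightarrow> real" and a b t1 t2 :: real
  assumes "prob_space M"
    and "abs_continuous_rv M X"
    and "AE \<omega> in M. 0 \<le> X \<omega>"
    and "a > 0" and "b > 0"
    and "Y = (\<lambda>\<omega>. a * X \<omega> + b)"
    and "rv_cdf M Y t1 < rv_cdf M Y t2"
    and "finite_varextropy_integrals M Y t1 t2"
  shows "interval_varextropy M Y t1 t2 =
           1 / a ^ 2 * interval_varextropy M X ((t1 - b) / a) ((t2 - b) / a)"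
proof -
  have cdf: "rv_cdf M Y t = rv_cdf M X ((t - b) / a)" for t
    using assms by (simp add: cdf_affine abs_continuous_rv_def)
  have int: "(LBINT x:{t1<..<t2}. rv_density M Y x ^ Suc n)
       = 1 / a ^ n * (LBINT x:{(t1 - b) / a<..<(t2 - b) / a}. rv_density M X x ^ Suc n)" for n
    unfolding \<open>Y = _\<close> using assms by (intro set_lebesgue_integral_rv_density_affine) auto
  show ?thesis
    unfolding interval_varextropy_def cdf
    \<comment> \<open>n = 1 gives the integral of the square, n = 2 that of the cube.\<close>
    using int[of 1] int[of 2]
    by (simp add: numeral_2_eq_2[symmetric] numeral_3_eq_3[symmetric] power_divide diff_divide_distrib
        mult.commute del: power_Suc)
qed

end
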